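(* Let $(z_1,\dots,z_n)\in\mathbb C^n$ be a maximizer, i.e. $|z_i-z_j|\le 2$ for all $i,j$ and $\Delta(z_1,\dots,z_n)=\Delta_{\max}(n)$. Then its diameter graph is either a caterpillar, or it consists of a cycle with an odd number of vertices together possibly with extra vertices, each of which is joined by edges only to vertices of the odd cycle (so every edge of the graph is incident with at least one vertex of the odd cycle).
   Context: $\Delta(z_1,\dots,z_n)=\prod_{i\neq j}|z_i-z_j|$ and $\Delta_{\max}(n)=\sup\{\Delta(z_1,\dots,z_n): \max_{i,j}|z_i-z_j|\le 2\}$. The diameter graph of a finite point set is the graph on the points in which two points are adjacent iff their distance equals the diameter (maximum pairwise distance) of the set. A caterpillar is a tree such that deleting all leaves leaves a path (possibly empty). *)

theory Defs
  imports "HOL-Analysis.Analysis"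
begin

text \<open>
  A tuple \<open>(z\<^sub>1, \<dots>, z\<^sub>n)\<close> of complex numbers is a function \<open>z :: nat \<Rightarrow> complex\<close> of which only the
  values on \<open>{1..n}\<close> are used.
\<close>

definition Delta :: "nat \<Rightarrow> (nat \<Rightarrow> complex) \<Rightarrow> real" where
  "Delta n z = (\<Prod>i\<in>{1..n}. \<Prod>j\<in>{1..n} - {i}. cmod (z i - z j))"

definition admissible :: "nat \<Rightarrow> (nat \<Rightarrow> complex) \<Rightarrow> bool" where
  "admissible n z \<longleftrightarrow> (\<forall>i\<in>{1..n}. \<forall>j\<in>{1..n}. cmod (z i - z j) \<le> 2)"

text \<open>
  The set below is nonempty and bounded above, so the real-valued \<open>Sup\<close> is the true supremum.
\<close>

definition Delta_max :: "nat \<Rightarrow> real" where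
  "Delta_max n = Sup {Delta n z | z. admissible n z}"

text \<open>
  A simple graph is given by a vertex set \<open>V\<close> and an edge set \<open>E\<close> of two-element subsets of \<open>V\<close>.
\<close>

definition path_edges :: "'a list \<Rightarrow> 'a set set" where
  "path_edges xs = {{xs ! i, xs ! Suc i} | i. Suc i < length xs}"

definition cycle_edges :: "'a list \<Rightarrow> 'a set set" where
  "cycle_edges xs = insert {last xs, hd xs} (path_edges xs)"

definition graph_connected :: "'a set \<Rightarrow> 'a set set \<Rightarrow> bool" where
  "graph_connected V E \<longleftrightarrow> V \<noteq> {} \<and>
     (\<forall>u\<in>V. \<forall>v\<in>V. \<exists>xs. xs \<noteq> [] \<and> hd xs = u \<and> last xs = v \<and> set xs \<subseteq> V \<and> path_edges xs \<subseteq> E)"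

definition graph_acyclic :: "'a set set \<Rightarrow> bool" where
  "graph_acyclic E \<longleftrightarrow> \<not> (\<exists>xs. distinct xs \<and> 3 \<le> length xs \<and> cycle_edges xs \<subseteq> E)"

definition is_tree :: "'a set \<Rightarrow> 'a set set \<Rightarrow> bool" where
  "is_tree V E \<longleftrightarrow> graph_connected V E \<and> graph_acyclic E"

definition leaves :: "'a set \<Rightarrow> 'a set set \<Rightarrow> 'a set" where
  "leaves V E = {v \<in> V. card {e \<in> E. v \<in> e} = 1}"

text \<open>The list may be empty or a singleton, giving the empty path and the one-vertex path.\<close>

definition is_path :: "'a set \<Rightarrow> 'a set set \<Rightarrow> bool" where
  "is_path V E \<longleftrightarrow> (\<exists>xs. distinct xs \<and> set xs = V \<and> E = path_edges xs)"

definition caterpillar :: "'a set \<Rightarrow> 'a set set \<Rightarrow> bool" where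
  "caterpillar V E \<longleftrightarrow> is_tree V E \<and>
     (let W = V - leaves V E in is_path W {e \<in> E. e \<subseteq> W})"

text \<open>
  An odd cycle together with possibly some extra vertices: the only edges between vertices of the
  cycle are those of the cycle itself (no chords), and each extra vertex is joined to
  at least one vertex of the cycle and to no vertex outside the cycle.
\<close>

definition odd_cycle_with_extras :: "'a set \<Rightarrow> 'a set set \<Rightarrow> bool" where
  "odd_cycle_with_extras V E \<longleftrightarrow>
     (\<exists>xs. distinct xs \<and> 3 \<le> length xs \<and> odd (length xs) \<and> set xs \<subseteq> V \<and>
        {e \<in> E. e \<subseteq> set xs} = cycle_edges xs \<and>
        (\<forall>v\<in>V - set xs. (\<exists>u. {u, v} \<in> E) \<and> (\<forall>u. {u, v} \<in> E \<longrightarrow> u \<in> set xs)))"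

definition diameter_edges :: "'a::metric_space set \<Rightarrow> 'a set set" where
  "diameter_edges P = {{x, y} | x y. x \<in> P \<and> y \<in> P \<and> x \<noteq> y \<and> dist x y = diameter P}"

end

theory Submission
  imports Defs "HOL-Complex_Analysis.Conformal_Mappings"
begin

text \<open>
  If no diameter joined a part \<open>A\<close> of a maximizer to the remaining points, then \<open>A\<close> could be
  translated by every small complex \<open>w\<close>; as \<open>\<Delta>\<close> is the modulus of a polynomial in \<open>w\<close>, the maximum
  modulus principle would make this polynomial constant, although it vanishes as soon as two points
  collide. Hence the diameter graph is connected. Two diameters without a common endpoint cross,
  and this forces every vertex to have at most two neighbours of degree at least 2 and every
  cycle to be odd: the other vertices of a cycle alternate between the two sides of one of its edges.
  So what remains after deleting the leaves is a path or an odd cycle.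
\<close>

section \<open>Graphs given by edge sets\<close>

lemma path_edges_iff: "e \<in> path_edges xs \<longleftrightarrow> (\<exists>i. Suc i < length xs \<and> e = {xs ! i, xs ! Suc i})"
  by (auto simp: path_edges_def)

lemma nth_in_path_edges: "Suc i < length xs \<Longrightarrow> {xs ! i, xs ! Suc i} \<in> path_edges xs"
  unfolding path_edges_def by blast

lemma path_edges_subset_set: "e \<in> path_edges xs \<Longrightarrow> e \<subseteq> set xs"
  by (auto simp: path_edges_iff)

lemma path_edges_Cons: "xs \<noteq> [] \<Longrightarrow> path_edges (x # xs) = insert {x, hd xs} (path_edges xs)"
proof (intro set_eqI iffI)
  fix e assume ne: "xs \<noteq> []" and "e \<in> path_edges (x # xs)"
  then obtain i where "Suc i < length (x # xs)" "e = {(x # xs) ! i, (x # xs) ! Suc i}"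
    by (auto simp: path_edges_iff)
  with ne show "e \<in> insert {x, hd xs} (path_edges xs)"
    by (cases i) (auto simp: path_edges_iff hd_conv_nth)
next
  fix e assume ne: "xs \<noteq> []" and "e \<in> insert {x, hd xs} (path_edges xs)"
  then consider "e = {x, hd xs}" | i where "Suc i < length xs" "e = {xs ! i, xs ! Suc i}"
    by (auto simp: path_edges_iff)
  then show "e \<in> path_edges (x # xs)"
  proof cases
    case 1
    with ne show ?thesis by (auto simp: path_edges_iff hd_conv_nth intro!: exI[of _ 0])
  next
    case (2 i)
    then show ?thesis unfolding path_edges_iff by (intro exI[of _ "Suc i"]) auto
  qed
qed

lemma path_edges_snoc:
  assumes "xs \<noteq> []"
  shows "path_edges (xs @ [x]) = insert {last xs, x} (path_edges xs)"
  using assms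
proof (induction xs)
  case (Cons y xs)
  then show ?case
    by (cases "xs = []") (auto simp: path_edges_Cons hd_append path_edges_def[of "[_]"])
qed simp

text \<open>Membership in \<open>S\<close> propagates along a path from any vertex of
  \<open>S\<close>. It is applied with \<open>S\<close> a cycle or a longest path together with the
  leaves attached to it, to show that no other vertices exist.\<close>

lemma graph_connected_closed:
  assumes "graph_connected V E" and "S \<inter> V \<noteq> {}"
    and closed: "\<And>x y. x \<in> S \<Longrightarrow> {x, y} \<in> E \<Longrightarrow> y \<in> S"
  shows "V \<subseteq> S"
proof
  fix v assume "v \<in> V"
  obtain u where u: "u \<in> S" "u \<in> V" using assms(2) by blast
  obtain xs where xs: "xs \<noteq> []" "hd xs = u" "last xs = v" "path_edges xs \<subseteq> E"
    using assms(1) \<open>v \<in> V\<close> u unfolding graph_connected_def by blast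
  have "i < length xs \<Longrightarrow> xs ! i \<in> S" for i
  proof (induction i)
    case 0
    then show ?case using xs u by (simp add: hd_conv_nth)
  next
    case (Suc i)
    then have "{xs ! i, xs ! Suc i} \<in> E" using nth_in_path_edges[of i xs] xs by blast
    then show ?case using Suc closed[of "xs ! i"] by simp
  qed
  from this[of "length xs - 1"] show "v \<in> S"
    using xs by (simp add: last_conv_nth)
qed

text \<open>No edge leaves the set of vertices reachable from \<open>u\<close>, which
  \<open>cut\<close> permits only if that set is \<open>V\<close>. In this form connectedness
  becomes a statement about moving one part of a configuration.\<close>

lemma graph_connected_cut:
  assumes "V \<noteq> {}"
    and sub: "\<And>e. e \<in> E \<Longrightarrow> e \<subseteq> V"
    and cut: "\<And>A. A \<subseteq> V \<Longrightarrow> A \<noteq> {} \<Longrightarrow> A \<noteq> V \<Longrightarrow> \<exists>x\<in>A. \<exists>y\<in>V - A. {x, y} \<in> E"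
  shows "graph_connected V E"
  unfolding graph_connected_def
proof (intro conjI ballI)
  fix u v assume "u \<in> V" "v \<in> V"
  define P where "P xs v \<longleftrightarrow> xs \<noteq> [] \<and> hd xs = u \<and> last xs = v \<and> set xs \<subseteq> V \<and> path_edges xs \<subseteq> E"
    for xs v
  define A where "A = {v. \<exists>xs. P xs v}"
  have "P [u] u" using \<open>u \<in> V\<close> by (auto simp: P_def path_edges_def)
  then have "u \<in> A" by (auto simp: A_def)
  have "A \<subseteq> V" by (auto simp: A_def P_def)
  have "A = V"
  proof (rule ccontr)
    assume "A \<noteq> V"
    with cut[of A] \<open>A \<subseteq> V\<close> \<open>u \<in> A\<close> obtain x y where xy: "x \<in> A" "y \<in> V - A" "{x, y} \<in> E" by blast
    then obtain xs where "P xs x" by (auto simp: A_def)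
    then have "P (xs @ [y]) y"
      using xy by (auto simp: P_def path_edges_snoc)
    with xy show False by (auto simp: A_def)
  qed
  then show "\<exists>xs. xs \<noteq> [] \<and> hd xs = u \<and> last xs = v \<and> set xs \<subseteq> V \<and> path_edges xs \<subseteq> E"
    using \<open>v \<in> V\<close> by (auto simp: A_def P_def)
qed fact

section \<open>Leaves\<close>

lemma leaf_neighbour_unique:
  assumes "v \<in> leaves V E" "{a, v} \<in> E" "{b, v} \<in> E"
  shows "a = b"
proof -
  have "card {e \<in> E. v \<in> e} = 1" using assms by (auto simp: leaves_def)
  then obtain e where e: "{e \<in> E. v \<in> e} = {e}" by (auto simp: card_1_singleton_iff)
  have "{x, v} = e" if "{x, v} \<in> E" for x
  proof -
    from that have "{x, v} \<in> {e \<in> E. v \<in> e}" by simp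
    with e show ?thesis by simp
  qed
  with assms have "{a, v} = {b, v}" by metis
  then show ?thesis by (auto simp: doubleton_eq_iff)
qed

lemma leafI:
  assumes "v \<in> V" "{a, v} \<in> E" and "\<And>b. {b, v} \<in> E \<Longrightarrow> b = a"
    and "\<And>e. e \<in> E \<Longrightarrow> \<exists>x y. e = {x, y}"
  shows "v \<in> leaves V E"
proof -
  have "{e \<in> E. v \<in> e} = {{a, v}}"
  proof (intro set_eqI iffI)
    fix e assume e: "e \<in> {e \<in> E. v \<in> e}"
    then obtain x y where "e = {x, y}" using assms(4) by blast
    with e obtain b where "e = {b, v}" by blast
    with e assms(3)[of b] show "e \<in> {{a, v}}" by simp
  next
    fix e assume "e \<in> {{a, v}}"
    with assms(2) show "e \<in> {e \<in> E. v \<in> e}" by simp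
  qed
  then show ?thesis using assms(1) by (simp add: leaves_def)
qed

section \<open>Cycles, chords and the shape of the graph\<close>

lemma cycle_edges_conv:
  assumes "xs \<noteq> []"
  shows "cycle_edges xs = insert {xs ! (length xs - 1), xs ! 0} (path_edges xs)"
  using assms by (simp add: cycle_edges_def hd_conv_nth last_conv_nth)

lemma cycle_edges_subset_set: "xs \<noteq> [] \<Longrightarrow> e \<in> cycle_edges xs \<Longrightarrow> e \<subseteq> set xs"
  using path_edges_subset_set[of e xs] by (auto simp: cycle_edges_def)

text \<open>Length at least 3 keeps the cyclic predecessor and successor apart. This is why vertices
  of a cycle are never leaves.\<close>

lemma cycle_neighbours:
  assumes "distinct xs" "3 \<le> length xs" "x \<in> set xs"
  obtains p q where "p \<in> set xs" "q \<in> set xs" "p \<noteq> q"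
    "{x, p} \<in> cycle_edges xs" "{x, q} \<in> cycle_edges xs"
proof -
  have ne: "xs \<noteq> []" using assms by auto
  obtain i where i: "i < length xs" "x = xs ! i" using assms by (auto simp: in_set_conv_nth)
  define m where "m = length xs"
  have step: "{xs ! j, xs ! Suc j} \<in> cycle_edges xs" if "Suc j < m" for j
    using that nth_in_path_edges[of j xs] by (simp add: cycle_edges_def m_def)
  have close: "{xs ! 0, xs ! (m - 1)} \<in> cycle_edges xs"
    using ne by (auto simp: cycle_edges_conv m_def insert_commute)
  have m: "3 \<le> m" "i < m" using assms i by (auto simp: m_def)
  have inj: "xs ! j \<noteq> xs ! k" if "j < m" "k < m" "j \<noteq> k" for j k
    using that assms by (simp add: nth_eq_iff_index_eq m_def)
  have mem: "xs ! j \<in> set xs" if "j < m" for j using that by (simp add: m_def)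
  consider "i = 0" | "i = m - 1" "0 < i" | "0 < i" "Suc i < m" using m by linarith
  then show ?thesis
  proof cases
    case 1
    show ?thesis
      by (rule that[of "xs ! 1" "xs ! (m - 1)"])
        (use 1 m i step[of 0] close inj[of 1 "m - 1"] mem[of 1] mem[of "m - 1"] in auto)
  next
    case 2
    show ?thesis
      by (rule that[of "xs ! (m - 2)" "xs ! 0"])
        (use 2 m i step[of "m - 2"] close inj[of "m - 2" 0] mem[of "m - 2"] mem[of 0] in
          \<open>auto simp: insert_commute Suc_diff_Suc numeral_2_eq_2\<close>)
  next
    case 3
    show ?thesis
      by (rule that[of "xs ! (i - 1)" "xs ! Suc i"])
        (use 3 m i step[of "i - 1"] step[of i] inj[of "i - 1" "Suc i"] mem[of "i - 1"]
          mem[of "Suc i"] in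
          \<open>auto simp: insert_commute\<close>)
  qed
qed

text \<open>The stretch of the path from position \<open>i\<close> to \<open>j\<close> has at least
  three vertices since \<open>Suc i < j\<close>, and the chord closes it to a cycle.\<close>

lemma chord_gives_cycle:
  assumes "distinct xs" "path_edges xs \<subseteq> E" "j < length xs" "Suc i < j" "{xs ! i, xs ! j} \<in> E"
  shows "\<not> graph_acyclic E"
proof -
  define ys where "ys = drop i (take (Suc j) xs)"
  have len: "length ys = Suc j - i" using assms by (simp add: ys_def)
  have nth: "ys ! k = xs ! (i + k)" if "k < length ys" for k
    using that assms by (simp add: ys_def)
  have "distinct ys" using assms by (simp add: ys_def)
  moreover have "3 \<le> length ys" using assms len by auto
  moreover have "path_edges ys \<subseteq> E"
  proof
    fix e assume "e \<in> path_edges ys"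
    then obtain k where k: "Suc k < length ys" "e = {ys ! k, ys ! Suc k}"
      by (auto simp: path_edges_iff)
    then have "e \<in> path_edges xs"
      using assms len nth[of k] nth[of "Suc k"]
      unfolding path_edges_iff by (intro exI[of _ "i + k"]) auto
    with assms show "e \<in> E" by blast
  qed
  moreover have "{ys ! (length ys - 1), ys ! 0} = {xs ! i, xs ! j}"
    using nth[of 0] nth[of "length ys - 1"] len assms by auto
  ultimately have "distinct ys \<and> 3 \<le> length ys \<and> cycle_edges ys \<subseteq> E"
    using assms by (subst cycle_edges_conv) auto
  then show ?thesis unfolding graph_acyclic_def by blast
qed

text \<open>By \<open>three\<close> no vertex has three non-leaf neighbours. A vertex of the cycle
  already has two, next to it on the cycle, so its other neighbours are leaves. Hence there are no
  chords, and the cycle with its attached leaves is closed under adjacency.\<close>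

lemma cyclic_structure:
  assumes conn: "graph_connected V E"
    and edge: "\<And>e. e \<in> E \<Longrightarrow> \<exists>x y. x \<in> V \<and> y \<in> V \<and> e = {x, y}"
    and three: "\<And>a b c d. {a, b} \<in> E \<Longrightarrow> {a, c} \<in> E \<Longrightarrow> {a, d} \<in> E \<Longrightarrow> distinct [b, c, d]
      \<Longrightarrow> b \<in> leaves V E \<or> c \<in> leaves V E \<or> d \<in> leaves V E"
    and xs: "distinct xs" "3 \<le> length xs" "odd (length xs)" "cycle_edges xs \<subseteq> E"
  shows "odd_cycle_with_extras V E"
proof -
  have ne: "xs \<noteq> []" using xs by auto
  have inV: "x \<in> V" if "{x, y} \<in> E" for x y using edge[OF that] by (auto simp: doubleton_eq_iff)
  have setV: "set xs \<subseteq> V"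
    using cycle_neighbours[OF xs(1,2)] xs(4) inV by (metis subsetD subsetI)
  have nonleaf: "x \<notin> leaves V E" if x: "x \<in> set xs" for x
  proof
    assume "x \<in> leaves V E"
    moreover obtain p q where "p \<noteq> q" "{x, p} \<in> cycle_edges xs" "{x, q} \<in> cycle_edges xs"
      using cycle_neighbours[OF xs(1,2) x] by metis
    ultimately show False
      using leaf_neighbour_unique[of x V E p q] xs(4) by (auto simp: insert_commute)
  qed
  have nbr: "{x, y} \<in> cycle_edges xs" if x: "x \<in> set xs" and y: "{x, y} \<in> E" "y \<notin> leaves V E" for x y
  proof -
    obtain p q where pq: "p \<in> set xs" "q \<in> set xs" "p \<noteq> q"
      "{x, p} \<in> cycle_edges xs" "{x, q} \<in> cycle_edges xs"
      using cycle_neighbours[OF xs(1,2) x] by metis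
    with three[of x y p q] y nonleaf[of p] nonleaf[of q] xs(4) have "y = p \<or> y = q" by auto
    with pq show ?thesis by auto
  qed
  define S where "S = set xs \<union> {l \<in> leaves V E. \<exists>x\<in>set xs. {x, l} \<in> E}"
  have "V \<subseteq> S"
  proof (rule graph_connected_closed[OF conn])
    have "hd xs \<in> set xs" using ne by simp
    then show "S \<inter> V \<noteq> {}" using setV by (auto simp: S_def)
  next
    fix x y assume x: "x \<in> S" and xy: "{x, y} \<in> E"
    show "y \<in> S"
    proof (cases "x \<in> set xs")
      case True
      then show ?thesis
        using nbr[OF True xy] xy cycle_edges_subset_set[OF ne, of "{x, y}"] by (auto simp: S_def)
    next
      case False
      with x obtain u where "x \<in> leaves V E" "u \<in> set xs" "{u, x} \<in> E" by (auto simp: S_def)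
      with xy leaf_neighbour_unique[of x V E u y] show ?thesis
        by (auto simp: S_def insert_commute)
    qed
  qed
  moreover have "{e \<in> E. e \<subseteq> set xs} = cycle_edges xs"
  proof (intro set_eqI iffI)
    fix e assume e: "e \<in> {e \<in> E. e \<subseteq> set xs}"
    then have "e \<in> E" by simp
    from edge[OF this] obtain x y where "e = {x, y}" by blast
    with e nbr[of x y] nonleaf[of y] show "e \<in> cycle_edges xs" by auto
  qed (use xs(4) cycle_edges_subset_set[OF ne] in blast)
  moreover have "(\<exists>u. {u, v} \<in> E) \<and> (\<forall>u. {u, v} \<in> E \<longrightarrow> u \<in> set xs)" if v: "v \<in> V - set xs" for v
  proof -
    from v \<open>V \<subseteq> S\<close> obtain x where "v \<in> leaves V E" "x \<in> set xs" "{x, v} \<in> E"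
      by (auto simp: S_def)
    then show ?thesis using leaf_neighbour_unique[of v V E x] by blast
  qed
  ultimately show ?thesis
    unfolding odd_cycle_with_extras_def using xs setV by (intro exI[of _ xs]) blast
qed

text \<open>A longest path of non-leaves has no further non-leaf neighbour: at an end it could be
  prolonged, at an inner vertex \<open>three\<close> would fail. By connectedness it contains all
  non-leaves, and acyclicity excludes any other edge among them.\<close>

lemma acyclic_structure:
  assumes fin: "finite V" and conn: "graph_connected V E"
    and edge: "\<And>e. e \<in> E \<Longrightarrow> \<exists>x y. x \<in> V \<and> y \<in> V \<and> x \<noteq> y \<and> e = {x, y}"
    and three: "\<And>a b c d. {a, b} \<in> E \<Longrightarrow> {a, c} \<in> E \<Longrightarrow> {a, d} \<in> E \<Longrightarrow> distinct [b, c, d]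
      \<Longrightarrow> b \<in> leaves V E \<or> c \<in> leaves V E \<or> d \<in> leaves V E"
    and acyc: "graph_acyclic E"
  shows "caterpillar V E"
proof -
  define W where "W = V - leaves V E"
  have inV: "x \<in> V" if "{x, y} \<in> E" for x y using edge[OF that] by (auto simp: doubleton_eq_iff)
  have "is_path W {e \<in> E. e \<subseteq> W}"
  proof (cases "W = {}")
    case True
    have "{e \<in> E. e \<subseteq> W} = path_edges []"
      using edge by (auto simp: True path_edges_def)
    then show ?thesis unfolding is_path_def using True by (intro exI[of _ "[]"]) auto
  next
    case False
    define P where "P xs \<longleftrightarrow> distinct xs \<and> xs \<noteq> [] \<and> set xs \<subseteq> W \<and> path_edges xs \<subseteq> E" for xs
    obtain w where "w \<in> W" using False by blast
    then have "P [w]" by (auto simp: P_def path_edges_def)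
    \<comment> \<open>\<open>Suc\<close> supplies the strict bound that
      \<open>ex_has_greatest_nat\<close> asks for.\<close>
    moreover have "\<forall>xs. P xs \<longrightarrow> length xs < Suc (card W)"
    proof (intro allI impI)
      fix xs assume "P xs"
      then have "length xs = card (set xs)" "set xs \<subseteq> W" by (auto simp: P_def distinct_card)
      then show "length xs < Suc (card W)"
        using fin by (auto simp: W_def less_Suc_eq_le intro!: card_mono)
    qed
    ultimately have "\<exists>xs. P xs \<and> (\<forall>ys. P ys \<longrightarrow> length ys \<le> length xs)"
      by (rule ex_has_greatest_nat)
    then obtain xs where Pxs: "P xs" and max: "\<And>ys. P ys \<Longrightarrow> length ys \<le> length xs"
      by auto
    then have xs: "distinct xs" "xs \<noteq> []" "set xs \<subseteq> W" "path_edges xs \<subseteq> E"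
      by (auto simp: P_def)
    have step: "{xs ! j, xs ! Suc j} \<in> E" if "Suc j < length xs" for j
      using nth_in_path_edges[OF that] xs(4) by blast
    have nbr: "y \<in> set xs" if x: "x \<in> set xs" and y: "{x, y} \<in> E" "y \<in> W" for x y
    proof (rule ccontr)
      assume yn: "y \<notin> set xs"
      obtain i where i: "i < length xs" "x = xs ! i" using x by (auto simp: in_set_conv_nth)
      consider "i = 0" | "i = length xs - 1" | j where "i = Suc j" "Suc i < length xs"
        using i by (cases i) force+
      then show False
      proof cases
        case 1
        then have "P (y # xs)"
          using xs i y yn by (auto simp: P_def path_edges_Cons hd_conv_nth insert_commute)
        from max[OF this] show False by simp
      next
        case 2
        then have "P (xs @ [y])"
          using xs i y yn by (auto simp: P_def path_edges_snoc last_conv_nth)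
        from max[OF this] show False by simp
      next
        case (3 j)
        then have "{x, xs ! j} \<in> E" "{x, xs ! Suc i} \<in> E"
          using step[of j] step[of i] i by (auto simp: insert_commute)
        moreover have "xs ! j \<noteq> xs ! Suc i" "xs ! j \<in> set xs" "xs ! Suc i \<in> set xs"
          using 3 xs by (auto simp: nth_eq_iff_index_eq)
        ultimately show False
          using three[of x y "xs ! j" "xs ! Suc i"] y yn xs(3) by (auto simp: W_def)
      qed
    qed
    define S where "S = set xs \<union> {l \<in> leaves V E. \<exists>x\<in>set xs. {x, l} \<in> E}"
    have "V \<subseteq> S"
    proof (rule graph_connected_closed[OF conn])
      have "hd xs \<in> set xs" using xs by simp
      then show "S \<inter> V \<noteq> {}" using xs(3) by (auto simp: S_def W_def)
    next
      fix x y assume x: "x \<in> S" and xy: "{x, y} \<in> E"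
      have yV: "y \<in> V" using inV[of y x] xy by (simp add: insert_commute)
      show "y \<in> S"
      proof (cases "x \<in> set xs")
        case True
        then show ?thesis using nbr[OF True xy] xy yV by (auto simp: S_def W_def)
      next
        case False
        with x obtain u where "x \<in> leaves V E" "u \<in> set xs" "{u, x} \<in> E" by (auto simp: S_def)
        with xy leaf_neighbour_unique[of x V E u y] show ?thesis
          by (auto simp: S_def insert_commute)
      qed
    qed
    then have set: "set xs = W" using xs(3) by (auto simp: S_def W_def)
    have "{e \<in> E. e \<subseteq> W} = path_edges xs"
    proof (intro set_eqI iffI)
      fix e assume e: "e \<in> {e \<in> E. e \<subseteq> W}"
      then have "e \<in> E" by simp
      from edge[OF this] obtain x y where "x \<noteq> y" "e = {x, y}" by blast
      with e have "x \<in> set xs" "y \<in> set xs" "x \<noteq> y" by (auto simp: set)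
      then obtain i j where ij: "i < length xs" "x = xs ! i" "j < length xs" "y = xs ! j"
        by (auto simp: in_set_conv_nth)
      define k l where "k = min i j" and "l = max i j"
      have kl: "k < l" "l < length xs" "e = {xs ! k, xs ! l}"
        using ij \<open>x \<noteq> y\<close> \<open>e = {x, y}\<close>
        by (cases i j rule: linorder_cases; auto simp: k_def l_def insert_commute)+
      have "l = Suc k"
      proof (rule ccontr)
        assume "l \<noteq> Suc k"
        with chord_gives_cycle[OF xs(1,4) kl(2), of k] kl e acyc show False by auto
      qed
      with kl show "e \<in> path_edges xs" by (auto simp: path_edges_iff)
    next
      fix e assume "e \<in> path_edges xs"
      then show "e \<in> {e \<in> E. e \<subseteq> W}" using xs(4) set path_edges_subset_set[of e xs] by auto
    qed
    then show ?thesis unfolding is_path_def using xs set by blast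
  qed
  then show ?thesis
    using conn acyc by (simp add: caterpillar_def is_tree_def W_def Let_def)
qed

section \<open>Sides of a diameter\<close>

text \<open>The similarity with a to 0 and b to 1 is applied to c. The value is the signed distance
  of c from the line ab, divided by |b - a|, and is positive to the left of the direction from a to
  b.\<close>

definition side :: "complex \<Rightarrow> complex \<Rightarrow> complex \<Rightarrow> real" where
  "side a b c = Im ((c - a) / (b - a))"

text \<open>If Re d \<le> Re c, then d lies in the rectangle with opposite corners 0 and c, so |c -
  d|^2 \<le> |c|^2 - |d|^2 < 1. Otherwise the same estimate holds with 1 in place of 0.\<close>

lemma unit_diameters_cross_aux:
  assumes "cmod c \<le> 1" "cmod (c - 1) \<le> 1" "cmod d \<le> 1" "cmod (d - 1) \<le> 1" "cmod (c - d) = 1"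
    and "d \<notin> {0, 1}" "0 \<le> Im d" "Im d \<le> Im c"
  shows False
proof -
  have sq: "(Re w)\<^sup>2 + (Im w)\<^sup>2 \<le> 1" if "cmod w \<le> 1" for w
    using power_le_one[OF norm_ge_zero that, of 2] cmod_power2[of w] by simp
  have c: "(Re c)\<^sup>2 + (Im c)\<^sup>2 \<le> 1" "(Re c - 1)\<^sup>2 + (Im c)\<^sup>2 \<le> 1"
    using sq[OF assms(1)] sq[OF assms(2)] by simp_all
  have cd: "(Re c - Re d)\<^sup>2 + (Im c - Im d)\<^sup>2 = 1"
    using assms(5) cmod_power2[of "c - d"] by simp
  have d01: "0 \<le> Re d" "Re d \<le> 1"
    using abs_Re_le_cmod[of d] abs_Re_le_cmod[of "d - 1"] assms(3,4) by auto
  have im: "(Im c - Im d)\<^sup>2 = (Im c)\<^sup>2 - Im d * (2 * Im c - Im d)"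
    by (simp add: power2_eq_square algebra_simps)
  have im_ge: "Im d * (2 * Im c - Im d) \<ge> (Im d)\<^sup>2"
    using assms(7,8) by (auto simp: power2_eq_square intro!: mult_left_mono)
  show False
  proof (cases "Re d \<le> Re c")
    case True
    have "(Re c - Re d)\<^sup>2 = (Re c)\<^sup>2 - Re d * (2 * Re c - Re d)"
      by (simp add: power2_eq_square algebra_simps)
    moreover have "Re d * (2 * Re c - Re d) \<ge> (Re d)\<^sup>2"
      using True d01 by (auto simp: power2_eq_square intro!: mult_left_mono)
    ultimately have "(Re d)\<^sup>2 + (Im d)\<^sup>2 \<le> 0" using cd c im im_ge by linarith
    then have "d = 0" by (simp add: complex_eq_iff sum_power2_le_zero_iff)
    with assms(6) show False by simp
  next
    case False
    have "(Re c - Re d)\<^sup>2 = (Re c - 1)\<^sup>2 - (1 - Re d) * (2 * (1 - Re c) - (1 - Re d))"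
      by (simp add: power2_eq_square algebra_simps)
    moreover have "(1 - Re d) * (2 * (1 - Re c) - (1 - Re d)) \<ge> (1 - Re d)\<^sup>2"
      using False d01 by (auto simp: power2_eq_square intro!: mult_left_mono)
    ultimately have "(1 - Re d)\<^sup>2 + (Im d)\<^sup>2 \<le> 0" using cd c im im_ge by linarith
    then have "d = 1" by (simp add: complex_eq_iff sum_power2_le_zero_iff)
    with assms(6) show False by simp
  qed
qed

text \<open>Were c and d in one closed half-plane, conjugation would bring them to the upper one,
  and naming the lower point d gives the situation already excluded.\<close>

lemma unit_diameters_cross:
  assumes "cmod c \<le> 1" "cmod (c - 1) \<le> 1" "cmod d \<le> 1" "cmod (d - 1) \<le> 1" "cmod (c - d) = 1"
    and "c \<notin> {0, 1}" "d \<notin> {0, 1}"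
  shows "Im c * Im d < 0"
proof (rule ccontr)
  have cnj: "cmod (cnj x - cnj y) = cmod (x - y)" for x y
    by (metis complex_cnj_diff complex_mod_cnj)
  have cnj1: "cmod (cnj x - 1) = cmod (x - 1)" for x
    using cnj[of x 1] by simp
  have False if h: "cmod c \<le> 1" "cmod (c - 1) \<le> 1" "cmod d \<le> 1" "cmod (d - 1) \<le> 1"
    "cmod (c - d) = 1" "c \<notin> {0, 1}" "d \<notin> {0, 1}" "0 \<le> Im c" "0 \<le> Im d" for c d
    using unit_diameters_cross_aux[of c d] unit_diameters_cross_aux[of d c] h
    by (cases "Im d \<le> Im c") (auto simp: norm_minus_commute)
  note this[of c d] this[of "cnj c" "cnj d"]
  moreover assume "\<not> Im c * Im d < 0"
  then have "0 \<le> Im c \<and> 0 \<le> Im d \<or> Im c \<le> 0 \<and> Im d \<le> 0"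
    by (auto simp: mult_less_0_iff)
  ultimately show False
    using assms by (auto simp: cnj cnj1 complex_eq_iff)
qed

text \<open>Since |d| = |c - 1| = 1, expanding |c - d|^2 \<le> 1 gives Re c (1 - Re d) \<le> Im c Im
  d. Both factors on the left are positive, as 2 Re c = |c|^2 and 2 (1 - Re d) = |1 - d|^2.\<close>

lemma unit_adjacent_diameters:
  assumes "cmod d = 1" "cmod (c - 1) = 1" "cmod (c - d) \<le> 1" "c \<noteq> 0" "d \<noteq> 1"
  shows "0 < Im c * Im d"
proof -
  have d: "(Re d)\<^sup>2 + (Im d)\<^sup>2 = 1" using assms(1) cmod_power2[of d] by simp
  have c: "(Re c - 1)\<^sup>2 + (Im c)\<^sup>2 = 1" using assms(2) cmod_power2[of "c - 1"] by simp
  have cd: "(Re c - Re d)\<^sup>2 + (Im c - Im d)\<^sup>2 \<le> 1"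
    using power_le_one[OF norm_ge_zero assms(3), of 2] cmod_power2[of "c - d"] by simp
  have "0 < (Re c)\<^sup>2 + (Im c)\<^sup>2"
    using assms(4) by (simp add: complex_eq_iff sum_power2_gt_zero_iff)
  then have "0 < Re c" using c by (simp add: power2_eq_square algebra_simps)
  moreover have "0 < (1 - Re d)\<^sup>2 + (Im d)\<^sup>2"
    using assms(5) by (simp add: complex_eq_iff sum_power2_gt_zero_iff)
  then have "Re d < 1" using d by (simp add: power2_eq_square algebra_simps)
  ultimately have "0 < Re c * (1 - Re d)" by simp
  also have "\<dots> \<le> Im c * Im d"
    using c d cd by (simp add: power2_eq_square algebra_simps)
  finally show ?thesis .
qed

text \<open>The similarity underlying \<open>side\<close> divides every distance by D; it transfers
  the unit statements to arbitrary diameters.\<close>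

lemma cmod_normalized:
  assumes "dist a b = D" "0 < D"
  shows "cmod ((c - a) / (b - a)) = dist a c / D"
    and "cmod ((c - a) / (b - a) - 1) = dist b c / D"
    and "cmod ((c - a) / (b - a) - (d - a) / (b - a)) = dist c d / D"
proof -
  have ne: "b - a \<noteq> 0" and ba: "cmod (b - a) = D"
    using assms by (auto simp: dist_norm norm_minus_commute[of b a])
  show "cmod ((c - a) / (b - a)) = dist a c / D"
    by (simp add: norm_divide ba dist_norm norm_minus_commute[of c])
  have "(c - a) / (b - a) - 1 = (c - b) / (b - a)" using ne by (simp add: field_simps)
  then show "cmod ((c - a) / (b - a) - 1) = dist b c / D"
    by (simp add: norm_divide ba dist_norm norm_minus_commute[of c])
  have "(c - a) / (b - a) - (d - a) / (b - a) = (c - d) / (b - a)"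
    by (simp flip: diff_divide_distrib)
  then show "cmod ((c - a) / (b - a) - (d - a) / (b - a)) = dist c d / D"
    by (simp add: norm_divide ba dist_norm)
qed

text \<open>Only half of the crossing is recorded, namely that the line ab separates c from d; the
  sign count along a cycle uses just this.\<close>

lemma diameters_cross:
  assumes "0 < D" "dist a b = D" "dist c d = D"
    and "dist a c \<le> D" "dist a d \<le> D" "dist b c \<le> D" "dist b d \<le> D"
    and "c \<notin> {a, b}" "d \<notin> {a, b}"
  shows "side a b c * side a b d < 0"
  unfolding side_def
  by (rule unit_diameters_cross)
    (use assms in \<open>auto simp: cmod_normalized[OF assms(2,1)] field_simps\<close>)

text \<open>This concerns three consecutive diameters da, ab, bc. The points c and d may coincide,
  which covers triangles.\<close>

lemma adjacent_diameters_same_side: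
  assumes "0 < D" "dist a b = D" "dist a d = D" "dist b c = D" "dist c d \<le> D" "c \<noteq> a" "d \<noteq> b"
  shows "0 < side a b c * side a b d"
  unfolding side_def
  by (rule unit_adjacent_diameters)
    (use assms in \<open>auto simp: cmod_normalized[OF assms(2,1)] field_simps\<close>)

text \<open>The numerator of \<open>side\<close> is a determinant in b - a and c - a, hence
  antisymmetric, and equal lengths make the denominators agree.\<close>

lemma side_swap:
  assumes "dist a b = D" "dist a c = D"
  shows "side a c b = - side a b c"
proof -
  have "(Re (b - a))\<^sup>2 + (Im (b - a))\<^sup>2 = (Re (c - a))\<^sup>2 + (Im (c - a))\<^sup>2"
    using assms cmod_power2[of "b - a"] cmod_power2[of "c - a"]
    by (simp add: dist_norm norm_minus_commute)
  then show ?thesis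
    unfolding side_def Im_divide by (simp add: diff_divide_distrib mult.commute)
qed

section \<open>Diameter graphs in the plane\<close>

lemma diameter_edges_iff:
  "{x, y} \<in> diameter_edges P \<longleftrightarrow> x \<in> P \<and> y \<in> P \<and> x \<noteq> y \<and> dist x y = diameter P"
  by (auto simp: diameter_edges_def doubleton_eq_iff dist_commute)

lemma diameter_edges_pair:
  "e \<in> diameter_edges P \<Longrightarrow> \<exists>x y. x \<in> P \<and> y \<in> P \<and> x \<noteq> y \<and> e = {x, y}"
  by (auto simp: diameter_edges_def)

text \<open>A non-leaf neighbour x of a has a second diameter, which forces all other diameters at a
  to lie on one side of ax. Among three diameters at a this fails for the middle one.\<close>

lemma diameter_neighbours_leaf:
  fixes V :: "complex set"
  assumes fin: "finite V"
    and edges: "{a, b} \<in> diameter_edges V" "{a, c} \<in> diameter_edges V" "{a, d} \<in> diameter_edges V"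
    and "distinct [b, c, d]"
  shows "b \<in> leaves V (diameter_edges V) \<or> c \<in> leaves V (diameter_edges V)
    \<or> d \<in> leaves V (diameter_edges V)"
proof (rule ccontr)
  assume neg: "\<not> ?thesis"
  define D where "D = diameter V"
  have le: "dist x y \<le> D" if "x \<in> V" "y \<in> V" for x y
    using that diameter_bounded_bound[OF finite_imp_bounded[OF fin]] by (simp add: D_def)
  have dist: "dist a b = D" "dist a c = D" "dist a d = D"
    using edges by (auto simp: diameter_edges_iff D_def)
  have pos: "0 < D" using edges(1) dist(1) by (metis diameter_edges_iff zero_less_dist_iff)
  have same: "0 < side a x y * side a x w"
    if x: "{a, x} \<in> diameter_edges V" "x \<notin> leaves V (diameter_edges V)"
      and y: "{a, y} \<in> diameter_edges V" "y \<noteq> x" and w: "{a, w} \<in> diameter_edges V" "w \<noteq> x"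
    for x y w
  proof -
    \<comment> \<open>The diameter ux fixes the side: any diameter va with v different from x
      continues it to three consecutive diameters u, x, a, v.\<close>
    obtain u where u: "{u, x} \<in> diameter_edges V" "u \<noteq> a"
      using leafI[of x V a "diameter_edges V"] x diameter_edges_pair
      by (metis diameter_edges_iff)
    have "0 < side a x u * side a x v" if "{a, v} \<in> diameter_edges V" "v \<noteq> x" for v
      using that x u le
      by (intro adjacent_diameters_same_side[OF pos])
        (auto simp: diameter_edges_iff D_def dist_commute)
    from this[OF y] this[OF w] show ?thesis
      by (auto simp: zero_less_mult_iff)
  qed
  have "0 < side a b c * side a b d" "0 < side a c b * side a c d" "0 < side a d b * side a d c"
    using neg edges assms(5) by (auto intro!: same)
  \<comment> \<open>By antisymmetry the product of the three positive quantities is minus a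
    square.\<close>
  then show False
    using side_swap[OF dist(1,2)] side_swap[OF dist(1,3)] side_swap[OF dist(2,3)]
    by (auto simp: zero_less_mult_iff mult_less_0_iff)
qed

text \<open>Each edge disjoint from the first edge of the cycle crosses its line, so the vertices
  from index 2 to m - 1 alternate sides. The two extreme ones lie on the same side, hence m - 3 is
  even.\<close>

lemma diameter_cycle_odd:
  fixes V :: "complex set"
  assumes fin: "finite V" and xs: "distinct xs" "3 \<le> length xs"
    and cyc: "cycle_edges xs \<subseteq> diameter_edges V"
  shows "odd (length xs)"
proof (cases "length xs = 3")
  case False
  define m where "m = length xs"
  with False xs have m: "4 \<le> m" by auto
  define D where "D = diameter V"
  have ne: "xs \<noteq> []" using xs by auto
  have step: "{xs ! j, xs ! Suc j} \<in> diameter_edges V" if "Suc j < m" for j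
    using that cyc nth_in_path_edges[of j xs] unfolding cycle_edges_def m_def by blast
  have close: "{xs ! 0, xs ! (m - 1)} \<in> diameter_edges V"
    using ne cyc by (auto simp: cycle_edges_conv m_def insert_commute)
  have inV: "xs ! j \<in> V" if "j < m" for j
    using that close step[of j] by (cases "Suc j < m") (auto simp: diameter_edges_iff less_Suc_eq
        dest: less_antisym)
  have le: "dist (xs ! i) (xs ! j) \<le> D" if "i < m" "j < m" for i j
    using that inV diameter_bounded_bound[OF finite_imp_bounded[OF fin]] by (simp add: D_def)
  have len: "dist (xs ! j) (xs ! Suc j) = D" if "Suc j < m" for j
    using step[OF that] by (simp add: diameter_edges_iff D_def)
  have inj: "xs ! j = xs ! k \<longleftrightarrow> j = k" if "j < m" "k < m" for j k
    using that xs by (simp add: nth_eq_iff_index_eq m_def)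
  have "0 < dist (xs ! 0) (xs ! Suc 0)" using inj[of 0 "Suc 0"] m by simp
  then have pos: "0 < D" using len[of 0] m by simp
  define f where "f i = side (xs ! 0) (xs ! 1) (xs ! i)" for i
  have alt: "f i * f (Suc i) < 0" if "2 \<le> i" "Suc i < m" for i
    unfolding f_def
    by (rule diameters_cross[OF pos])
      (use that len[of 0] len[of i] in \<open>auto simp: le inj\<close>)
  \<comment> \<open>The vertices with indices m - 1, 0, 1, 2 carry three consecutive diameters, with
    the reference edge in the middle.\<close>
  have same: "0 < f 2 * f (m - 1)"
    unfolding f_def
  proof (rule adjacent_diameters_same_side[OF pos])
    show "dist (xs ! 0) (xs ! (m - 1)) = D"
      using close by (simp add: diameter_edges_iff D_def)
  qed (use m len[of 0] len[of 1] in \<open>auto simp: le inj numeral_2_eq_2\<close>)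
  \<comment> \<open>The exponent counts the side changes after index 2; k = m - 3 reaches the last
    vertex.\<close>
  have "2 + k < m \<Longrightarrow> 0 < f 2 * f (2 + k) * (- 1) ^ k" for k
  proof (induction k)
    case 0
    from same have "f 2 \<noteq> 0" by auto
    then show ?case by (auto simp: zero_less_mult_iff linorder_neq_iff)
  next
    case (Suc k)
    then have "0 < f 2 * f (2 + k) * (- 1) ^ k" by simp
    with alt[of "2 + k"] Suc.prems show ?case
      by (cases "even k") (auto simp: zero_less_mult_iff mult_less_0_iff)
  qed
  from this[of "m - 3"] m have "0 < f 2 * f (m - 1) * (- 1) ^ (m - 3)"
    by (auto simp: Suc_diff_Suc numeral_eq_Suc)
  with same have "even (m - 3)"
    by (cases "even (m - 3)") (auto simp: zero_less_mult_iff mult_less_0_iff)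
  with m show ?thesis by (simp add: m_def)
qed simp

section \<open>Maximizers\<close>

text \<open>Every factor is at most 2, so the set is bounded above and its real \<open>Sup\<close>
  is a genuine upper bound.\<close>

lemma Delta_le_Delta_max:
  assumes "admissible n y"
  shows "Delta n y \<le> Delta_max n"
  unfolding Delta_max_def
proof (rule cSup_upper)
  show "Delta n y \<in> {Delta n z | z. admissible n z}" using assms by blast
  have "Delta n z \<le> (\<Prod>i\<in>{1..n}. \<Prod>j\<in>{1..n} - {i}. 2)" if "admissible n z" for z
    unfolding Delta_def using that
    by (intro prod_mono conjI prod_nonneg ballI) (auto simp: admissible_def)
  then show "bdd_above {Delta n z | z. admissible n z}" by (auto intro!: bdd_aboveI)
qed

lemma Delta_max_pos: "0 < Delta_max n"
proof -
  \<comment> \<open>Distinct collinear points with spacing 2/n, so that the n points span less than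
    2.\<close>
  define y where "y i = complex_of_real (2 * real i / real n)" for i
  have diff: "cmod (y i - y j) = 2 * \<bar>real i - real j\<bar> / real n" for i j
  proof -
    have "y i - y j = complex_of_real (2 * (real i - real j) / real n)"
      by (simp add: y_def diff_divide_distrib right_diff_distrib)
    then show ?thesis by (simp only: norm_of_real abs_divide abs_mult abs_of_nat abs_numeral)
  qed
  have "admissible n y"
    unfolding admissible_def diff
  proof (intro ballI)
    fix i j assume "i \<in> {1..n}" "j \<in> {1..n}"
    then have "\<bar>real i - real j\<bar> \<le> real n" "0 < real n" by auto
    then show "2 * \<bar>real i - real j\<bar> / real n \<le> 2" by (simp add: field_simps)
  qed
  moreover have "0 < Delta n y"
    unfolding Delta_def diff by (intro prod_pos ballI) auto
  ultimately show ?thesis using Delta_le_Delta_max[of n y] by linarith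
qed

text \<open>Without a diameter across the cut, small translations of A keep the configuration
  admissible, so a polynomial of modulus \<open>Delta\<close> attains a local maximum of its modulus
  at 0 and is constant. A collision makes it 0, against the positivity of
  \<open>Delta_max\<close>.\<close>

lemma maximizer_cut:
  assumes adm: "admissible n z" and max: "Delta n z = Delta_max n"
    and A: "A \<subseteq> z ` {1..n}" "A \<noteq> {}" "A \<noteq> z ` {1..n}"
  shows "\<exists>x\<in>A. \<exists>y\<in>z ` {1..n} - A. {x, y} \<in> diameter_edges (z ` {1..n})"
proof (rule ccontr)
  define V where "V = z ` {1..n}"
  assume "\<not> ?thesis"
  then have neg: "{x, y} \<notin> diameter_edges V" if "x \<in> A" "y \<in> V - A" for x y
    using that unfolding V_def by blast
  have no_edge: "dist x y \<noteq> diameter V" if xy: "x \<in> A" "y \<in> V - A" for x y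
    using neg[OF xy] xy subsetD[OF A(1) xy(1), folded V_def] by (auto simp: diameter_edges_iff)
  have fin: "finite V" by (simp add: V_def)
  have diam: "diameter V \<le> 2"
    using adm by (intro diameter_le) (auto simp: admissible_def V_def dist_norm)
  \<comment> \<open>A distance across the cut is strictly below the diameter, which is at most 2;
    whether the diameter equals 2 does not matter.\<close>
  have lt: "cmod (x - y) < 2" if "x \<in> A" "y \<in> V - A" for x y
    using no_edge[OF that] diameter_bounded_bound[OF finite_imp_bounded[OF fin], of x y] that A diam
    by (auto simp: V_def dist_norm)
  obtain e where e: "0 < e" "\<And>x y. x \<in> A \<Longrightarrow> y \<in> V - A \<Longrightarrow> cmod (x - y) + e \<le> 2"
  proof
    \<comment> \<open>The slacks of the pairs across the cut. The inserted 1 makes \<open>S\<close>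
      visibly nonempty and leaves its minimum positive.\<close>
    define S where "S = insert 1 ((\<lambda>(x, y). 2 - cmod (x - y)) ` (A \<times> (V - A)))"
    have S: "finite S" "S \<noteq> {}"
      using fin A by (auto simp: S_def V_def intro!: finite_imageI finite_cartesian_product
          intro: finite_subset)
    show "0 < Min S" using S lt by (auto simp: Min_gr_iff S_def)
    show "cmod (x - y) + Min S \<le> 2" if "x \<in> A" "y \<in> V - A" for x y
    proof -
      have "2 - cmod (x - y) \<in> S" using that by (auto simp: S_def)
      then show ?thesis using S Min_le[of S "2 - cmod (x - y)"] by linarith
    qed
  qed
  \<comment> \<open>Distances within A and within the rest are unchanged, so only pairs across the
    cut need the slack \<open>e\<close>.\<close>
  define y where "y w i = (if z i \<in> A then z i + w else z i)" for w i
  define F where "F w = (\<Prod>i\<in>{1..n}. \<Prod>j\<in>{1..n} - {i}. y w i - y w j)" for w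
  have norm_F: "cmod (F w) = Delta n (y w)" for w
    by (simp add: F_def Delta_def prod_norm)
  have y0: "y 0 = z" by (auto simp: y_def)
  have "admissible n (y w)" if w: "cmod w < e" for w
    unfolding admissible_def
  proof (intro ballI)
    fix i j assume ij: "i \<in> {1..n}" "j \<in> {1..n}"
    then have V: "z i \<in> V" "z j \<in> V" and zij: "cmod (z i - z j) \<le> 2"
      using adm by (auto simp: V_def admissible_def)
    consider "z i \<in> A \<longleftrightarrow> z j \<in> A" | "z i \<in> A" "z j \<notin> A" | "z i \<notin> A" "z j \<in> A" by blast
    then show "cmod (y w i - y w j) \<le> 2"
    proof cases
      case 1
      then show ?thesis using zij by (auto simp: y_def)
    next
      case 2
      then have "cmod (z i - z j) + e \<le> 2" using e V by blast
      moreover have "cmod (y w i - y w j) \<le> cmod (z i - z j) + cmod w"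
        using 2 norm_triangle_ineq[of "z i - z j" w] by (simp add: y_def algebra_simps)
      ultimately show ?thesis using w by linarith
    next
      case 3
      then have "cmod (z i - z j) + e \<le> 2" using e(2)[of "z j" "z i"] V by (simp add: norm_minus_commute)
      moreover have "cmod (y w i - y w j) \<le> cmod (z i - z j) + cmod w"
        using 3 norm_triangle_ineq4[of "z i - z j" w] by (simp add: y_def algebra_simps)
      ultimately show ?thesis using w by linarith
    qed
  qed
  then have F_le: "cmod (F w) \<le> cmod (F 0)" if "w \<in> ball 0 e" for w
    using that Delta_le_Delta_max[of n "y w"] by (simp add: norm_F y0 max)
  have "(\<lambda>w. y w i) holomorphic_on UNIV" for i
    by (cases "z i \<in> A") (auto simp: y_def intro!: holomorphic_intros)
  then have "F holomorphic_on UNIV"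
    unfolding F_def by (intro holomorphic_intros)
  \<comment> \<open>Maximality is known only on the small ball, but the principle yields constancy
    on the whole connected plane.\<close>
  then have "F constant_on UNIV"
    using maximum_modulus_principle[of F UNIV "ball 0 e" 0] F_le e(1) by auto
  then have const: "F w = F 0" for w by (auto simp: constant_on_def)
  obtain i j where ij: "i \<in> {1..n}" "j \<in> {1..n}" "z i \<in> A" "z j \<notin> A"
    using A by blast
  \<comment> \<open>Translation by z j - z i moves point i onto point j; this shift may be far too
    large to be admissible, which is why constancy on the plane is needed.\<close>
  then have coll: "y (z j - z i) i = y (z j - z i) j" "i \<noteq> j" by (auto simp: y_def)
  have "(\<Prod>k\<in>{1..n} - {i}. y (z j - z i) i - y (z j - z i) k) = 0"
    by (rule prod_zero, simp, rule bexI[of _ j]) (use ij coll in simp_all)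
  then have "F (z j - z i) = 0"
    unfolding F_def by (intro prod_zero, simp) (use ij in blast)
  then have "Delta n z = 0" using const[of "z j - z i"] norm_F[of 0] y0 by simp
  with max Delta_max_pos[of n] show False by simp
qed

theorem theorem2p6:
  fixes n :: nat and z :: "nat \<Rightarrow> complex" and V :: "complex set" and E :: "complex set set"
  assumes "1 \<le> n"
    and "admissible n z"
    and "Delta n z = Delta_max n"
    and "V = z ` {1..n}"
    and "E = diameter_edges V"
  shows "caterpillar V E \<or> odd_cycle_with_extras V E"
proof -
  have fin: "finite V" using assms by simp
  have conn: "graph_connected V E"
  proof (rule graph_connected_cut)
    show "V \<noteq> {}" using assms by auto
    show "e \<subseteq> V" if "e \<in> E" for e using diameter_edges_pair[of e V] that assms by auto
    show "\<exists>x\<in>A. \<exists>y\<in>V - A. {x, y} \<in> E" if "A \<subseteq> V" "A \<noteq> {}" "A \<noteq> V" for A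
      using maximizer_cut[OF assms(2,3)] that assms(4,5) by simp
  qed
  note edge = diameter_edges_pair[of _ V, folded assms(5)]
  note three = diameter_neighbours_leaf[OF fin, folded assms(5)]
  \<comment> \<open>Without cycles the connected graph is a tree; any cycle is odd because its edges
    are diameters.\<close>
  show ?thesis
  proof (cases "graph_acyclic E")
    case True
    have "caterpillar V E"
      by (rule acyclic_structure[OF fin conn _ _ True]) (fact edge three)+
    then show ?thesis ..
  next
    case False
    then obtain xs where xs: "distinct xs" "3 \<le> length xs" "cycle_edges xs \<subseteq> E"
      by (auto simp: graph_acyclic_def)
    have odd: "odd (length xs)" using diameter_cycle_odd[OF fin xs(1,2)] xs(3) assms(5) by simp
    have "odd_cycle_with_extras V E"
    proof (rule cyclic_structure[OF conn _ _ xs(1,2) odd xs(3)])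
      show "\<exists>x y. x \<in> V \<and> y \<in> V \<and> e = {x, y}" if "e \<in> E" for e using edge[OF that] by blast
    qed (fact three)
    then show ?thesis ..
  qed
qed

end
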